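(* Let $(\lambda_n)_{n=1}^\infty,(\mu_n)_{n=1}^\infty\subseteq\mathbb{C}$ and suppose that $\lambda_n\cdot\mu_n\to\ell$, where $\ell\in\{\pm4,\pm2i\}$. Then for every $K\in\mathbb{N}$ there exists $N\in\mathbb{N}$ such that for every $n\ge N$, every relator of $G_{\lambda_n,\mu_n}$ has a subword $w$ of the form: (1) if $\ell=\pm4$: $w=(A_{\lambda_n}B_{\mu_n}^{-1})^k$ or $w=(A_{\lambda_n}^{-1}B_{\mu_n})^k$, where $k\ge K$; (2) if $\ell=\pm2i$: $w=A_{\lambda_n}^{n_1}B_{\mu_n}^{n_2}\cdots A_{\lambda_n}^{n_{k-1}}B_{\mu_n}^{n_k}$, where $k\ge K$ and $n_j\in\{\pm1\}$. In particular, $\sigma(G_{\lambda_n,\mu_n})\to\infty$ as $n\to\infty$.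
   Context: For $\lambda,\mu\in\mathbb{C}$ let $A_\lambda=\begin{pmatrix}1&\lambda\\0&1\end{pmatrix}$, $B_\mu=\begin{pmatrix}1&0\\ \mu&1\end{pmatrix}$, and $G_{\lambda,\mu}=\langle A_\lambda,B_\mu\rangle\subseteq\mathrm{SL}_2(\mathbb{C})$, with generating set $S=\{A_\lambda,B_\mu\}$. Words are reduced words in two formal letters corresponding to the generators (elements of the free group on these letters). A relator of $G_{\lambda,\mu}$ always means a nontrivial relator: a nonempty reduced word in the generators that equals $1$ in the group. A subword is a contiguous subword. If $w=s_1^{n_1}\cdots s_k^{n_k}$ is the reduced form of a word ($s_j\in S$, $s_j\neq s_{j+1}^{\pm1}$ as letters, $n_j\in\mathbb{Z}\setminus\{0\}$), its syllables are $s_1^{n_1},\dots,s_k^{n_k}$, and $\operatorname{syl}(w)=k$. For a group $G$ with generating set $S$, $\sigma(G)=\sigma_S(G)$ is the minimum of $\operatorname{syl}(w)$ over all relators $w$, and $\sigma(G)=\infty$ if $S$ freely generates $G$.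
   Formalization: For ℓ=−4 the words are corrected to (AB)^k or (A^{-1}B^{-1})^k; as printed the claim fails, e.g. λ_n=1, μ_n=−2−2cos(π/n) gives the positive relator (AB)^{2n}. The cases ℓ=4 and ℓ=±2i are as stated. *)

theory Defs
  imports
    "HOL-Analysis.Analysis"
    "HOL-Algebra.Elementary_Groups"
    "HOL-Library.Sublist"
    "HOL-Library.Extended_Real"
begin

text \<open>
  A generating set is given as a family \<open>s :: 'i \<Rightarrow> 'a\<close>, so that the letters are formal, i.e. distinct
  even if two generators coincide in the group. A word is a list of pairs \<open>(x, e)\<close> standing for the
  letter \<open>x\<close> if \<open>e\<close> holds and for \<open>x\<^sup>-\<^sup>1\<close> otherwise; the reduced words are the elements of the free
  group on \<open>'i\<close>.
\<close>

type_synonym 'i word = "('i \<times> bool) list"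

definition reduced :: "'i word \<Rightarrow> bool" where
  "reduced w \<longleftrightarrow> successively (\<lambda>a b. b \<noteq> (fst a, \<not> snd a)) w"

definition eval_letter :: "('a, 'm) monoid_scheme \<Rightarrow> ('i \<Rightarrow> 'a) \<Rightarrow> 'i \<times> bool \<Rightarrow> 'a" where
  "eval_letter G s a = (if snd a then s (fst a) else inv\<^bsub>G\<^esub> s (fst a))"

definition eval_word :: "('a, 'm) monoid_scheme \<Rightarrow> ('i \<Rightarrow> 'a) \<Rightarrow> 'i word \<Rightarrow> 'a" where
  "eval_word G s w = foldr (\<lambda>a g. eval_letter G s a \<otimes>\<^bsub>G\<^esub> g) w \<one>\<^bsub>G\<^esub>"

definition relator :: "('a, 'm) monoid_scheme \<Rightarrow> ('i \<Rightarrow> 'a) \<Rightarrow> 'i word \<Rightarrow> bool" where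
  "relator G s w \<longleftrightarrow> w \<noteq> [] \<and> reduced w \<and> eval_word G s w = \<one>\<^bsub>G\<^esub>"

definition letter_power :: "'i \<Rightarrow> int \<Rightarrow> 'i word" where
  "letter_power x n = replicate (nat \<bar>n\<bar>) (x, n > 0)"

text \<open>
  In a reduced word the syllables are the maximal blocks of equal underlying letters; see
  \<open>syl_syllables\<close> below.
\<close>

definition syl :: "'i word \<Rightarrow> nat" where
  "syl w = length (remdups_adj (map fst w))"

lemma syl_syllables:
  assumes "\<forall>(x, n) \<in> set ss. n \<noteq> 0" and "successively (\<lambda>a b. fst a \<noteq> fst b) ss"
  shows "syl (concat (map (\<lambda>(x, n). letter_power x n) ss)) = length ss"
proof -
  have replicate_app: "remdups_adj (replicate k x @ ys) = x # remdups_adj ys"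
    if "k > 0" "ys = [] \<or> hd ys \<noteq> x" for k and x :: 'a and ys
    using that
  proof (induction k)
    case (Suc k)
    then show ?case
      by (cases k; cases ys) (auto simp: remdups_adj_Cons split: list.splits)
  qed simp
  have "remdups_adj (map fst (concat (map (\<lambda>(x, n). letter_power x n) ss))) = map fst ss"
    using assms
  proof (induction ss)
    case (Cons a ss)
    obtain x n where a: "a = (x, n)" by fastforce
    let ?ys = "map fst (concat (map (\<lambda>(x, n). letter_power x n) ss))"
    have IH: "remdups_adj ?ys = map fst ss"
      using Cons by (auto simp: successively_Cons)
    have "?ys = [] \<or> hd ?ys \<noteq> x"
      using Cons.prems a
      by (cases ss) (auto simp: letter_power_def hd_append)
    then show ?case
      using replicate_app[of "nat \<bar>n\<bar>" ?ys x] IH Cons.prems a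
      by (simp add: letter_power_def)
  qed simp
  then show ?thesis
    by (metis syl_def length_map)
qed

text \<open>
  The minimum is taken in \<^typ>\<open>enat\<close>, where the infimum of the empty set is \<open>\<infinity>\<close>; this is the case
  where there is no relator, i.e. where \<open>s\<close> freely generates.
\<close>

definition min_syl :: "('a, 'm) monoid_scheme \<Rightarrow> ('i \<Rightarrow> 'a) \<Rightarrow> enat" where
  "min_syl G s = (INF w \<in> {w. relator G s w}. enat (syl w))"

definition SL2 :: "(complex^2^2) monoid" where
  "SL2 = \<lparr>carrier = {M. det M = 1}, monoid.mult = (**), one = mat 1\<rparr>"

definition mat_A :: "complex \<Rightarrow> complex^2^2" where
  "mat_A l = vector [vector [1, l], vector [0, 1]]"

definition mat_B :: "complex \<Rightarrow> complex^2^2" where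
  "mat_B m = vector [vector [1, 0], vector [m, 1]]"

datatype gen = Gen_A | Gen_B

fun gens :: "complex \<Rightarrow> complex \<Rightarrow> gen \<Rightarrow> complex^2^2" where
  "gens l m Gen_A = mat_A l"
| "gens l m Gen_B = mat_B m"

definition G_grp :: "complex \<Rightarrow> complex \<Rightarrow> (complex^2^2) monoid" where
  "G_grp l m = subgroup_generated SL2 {mat_A l, mat_B m}"

definition word_power :: "'i word \<Rightarrow> nat \<Rightarrow> 'i word" where
  "word_power w k = concat (replicate k w)"

text \<open>
  \<open>alternating_word n k\<close> is \<open>A\<^bsup>n 1\<^esup> B\<^bsup>n 2\<^esup> A\<^bsup>n 3\<^esup> \<dots>\<close> with \<open>k\<close> factors.
\<close>

definition alternating_word :: "(nat \<Rightarrow> int) \<Rightarrow> nat \<Rightarrow> gen word" where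
  "alternating_word n k =
     concat (map (\<lambda>j. letter_power (if odd j then Gen_A else Gen_B) (n j)) [1..<k+1])"

end

theory Submission
  imports Defs
begin

text \<open>
  The proof is a quantitative ping-pong argument. Write \<open>\<nu> = \<lambda> \<mu>\<close>. A word acts on vectors, and
  in suitable projective coordinates (one for each generator, inverse to each other) reading off
  its syllables \<open>x\<^sup>n\<close> from right to left amounts to the recursion \<open>z \<mapsto> n \<cdot> g\<^sub>x + 1 / z\<close> with \<open>g\<^sub>A =
  1\<close> and \<open>g\<^sub>B = \<nu>\<close>. If no value of this continued fraction vanishes, the word moves a suitable
  vector on a coordinate axis off both axes, so it is not a relator.

  To keep the values away from \<open>0\<close>, measure them by a size \<open>u\<close>: a multiple of the modulus when
  \<open>\<nu>\<close> is near \<open>\<plusminus>4\<close>, and a multiple of the distance to a line when \<open>\<nu>\<close> is near \<open>\<plusminus>2\<i>\<close>. In both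
  cases a syllable with exponent \<open>n\<close> changes the size from \<open>u\<close> to at least \<open>t \<bar>n\<bar> - 1 / u\<close>,
  where \<open>t\<close> tends to \<open>2\<close>. For \<open>\<bar>n\<bar> \<ge> 2\<close> this is at least \<open>3 / 2\<close> once \<open>u \<ge> 1\<close>. For \<open>\<bar>n\<bar> = 1\<close> and
  \<open>t = 2\<close> the recursion turns \<open>1 + 1 / m\<close> into \<open>1 + 1 / (m + 1)\<close>: it tends to the critical size
  \<open>1\<close> without reaching it, so by continuity in \<open>t\<close> the size stays at least \<open>1\<close> for any
  prescribed number \<open>K\<close> of consecutive syllables with exponent \<open>\<plusminus>1\<close> when \<open>t\<close> is close enough to
  \<open>2\<close>. Hence a relator must contain more than \<open>K\<close> such syllables in a row. Near \<open>\<plusminus>4\<close> two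
  neighbouring exponents \<open>\<plusminus>1\<close> only reduce the size if their signs make the two steps cancel, and
  so the long run has the sign pattern of a power of one of the two parabolic products. The
  locale \<open>expanding_sizes\<close> holds the common argument, \<open>size_cont_frac\<close> is its core, and the
  lemmas \<open>expanding_sizes_near_4\<close> and \<open>expanding_sizes_near_2i\<close> supply the two sizes. A long run
  also forces many syllables, which gives the last claim.
\<close>

section \<open>Syllables of reduced words\<close>

definition word_of_syllables :: "('i \<times> int) list \<Rightarrow> 'i word" where
  "word_of_syllables ss = concat (map (\<lambda>(x, n). letter_power x n) ss)"

definition proper_syllables :: "('i \<times> int) list \<Rightarrow> bool" where
  "proper_syllables ss \<longleftrightarrow>
     (\<forall>(x, n) \<in> set ss. n \<noteq> 0) \<and> successively (\<lambda>a b. fst a \<noteq> fst b) ss"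

lemma word_of_syllables_simps [simp]:
  "word_of_syllables [] = []"
  "word_of_syllables ((x, n) # ss) = letter_power x n @ word_of_syllables ss"
  "word_of_syllables (ss @ ss') = word_of_syllables ss @ word_of_syllables ss'"
  by (simp_all add: word_of_syllables_def)

lemma proper_syllables_Cons:
  "proper_syllables ((x, n) # ss) \<longleftrightarrow>
     n \<noteq> 0 \<and> (ss = [] \<or> x \<noteq> fst (hd ss)) \<and> proper_syllables ss"
  by (auto simp: proper_syllables_def successively_Cons)

lemma proper_syllables_append:
  assumes "proper_syllables (ss @ ss')"
  shows "proper_syllables ss" "proper_syllables ss'"
  using assms by (auto simp: proper_syllables_def successively_append_iff)

lemma letter_power_eq_Nil_iff [simp]: "letter_power x n = [] \<longleftrightarrow> n = 0"
  by (simp add: letter_power_def)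

lemma hd_letter_power: "n \<noteq> 0 \<Longrightarrow> hd (letter_power x n) = (x, n > 0)"
  by (simp add: letter_power_def)

lemma letter_power_extend:
  assumes "n \<noteq> 0"
  shows "(x, n > 0) # letter_power x n = letter_power x (if n > 0 then n + 1 else n - 1)"
proof -
  have "nat \<bar>if n > 0 then n + 1 else n - 1\<bar> = Suc (nat \<bar>n\<bar>)"
    using assms by (auto simp: nat_eq_iff)
  then show ?thesis
    using assms by (auto simp: letter_power_def)
qed

text \<open>
  Adding a letter on the left either lengthens the first syllable or starts a new one; since the
  word is reduced, a letter with the generator of the first syllable has the sign of its
  exponent.
\<close>

lemma reduced_word_has_syllables:
  assumes "reduced w"
  obtains ss where "proper_syllables ss" "w = word_of_syllables ss"
  using assms
proof (induction w arbitrary: thesis)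
  case Nil
  then show ?case
    by (metis word_of_syllables_simps(1) empty_iff list.set(1) proper_syllables_def successively.simps(1))
next
  case (Cons a w)
  obtain x e where a: "a = (x, e)" by fastforce
  have "reduced w" and hd: "w = [] \<or> hd w \<noteq> (x, \<not> e)"
    using Cons.prems(2) by (auto simp: reduced_def successively_Cons a)
  then obtain ss where ss: "proper_syllables ss" "w = word_of_syllables ss"
    using Cons.IH by blast
  have single: "[(x, e)] = letter_power x (if e then 1 else -1)"
    by (simp add: letter_power_def)
  show ?case
  proof (cases "ss \<noteq> [] \<and> fst (hd ss) = x")
    case True
    then obtain n ss' where eq: "ss = (x, n) # ss'"
      by (cases ss) auto
    then have n: "n \<noteq> 0" and "hd w = (x, n > 0)"
      using ss by (auto simp: proper_syllables_Cons hd_append hd_letter_power)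
    then have e: "e = (n > 0)"
      using hd ss eq by auto
    have "a # w = word_of_syllables ((x, if n > 0 then n + 1 else n - 1) # ss')"
      using letter_power_extend[OF n, of x] by (simp add: a ss(2) eq e)
    moreover have "proper_syllables ((x, if n > 0 then n + 1 else n - 1) # ss')"
      using ss(1) eq by (auto simp: proper_syllables_Cons)
    ultimately show ?thesis
      using Cons.prems(1) by blast
  next
    case False
    have "a # w = word_of_syllables ((x, if e then 1 else -1) # ss)"
      using single by (simp add: a ss(2))
    moreover have "proper_syllables ((x, if e then 1 else -1) # ss)"
      using ss(1) False by (auto simp: proper_syllables_Cons)
    ultimately show ?thesis
      using Cons.prems(1) by blast
  qed
qed

lemma alternating_word_syllables:
  "alternating_word n k =
     word_of_syllables (map (\<lambda>j. (if odd j then Gen_A else Gen_B, n j)) [1..<k+1])"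
  by (simp add: alternating_word_def word_of_syllables_def comp_def)

text \<open>
  Powers of \<open>A\<^sup>a B\<^sup>b\<close> are the alternating words with exponents \<open>a, b, a, b, \<dots>\<close>; this turns the
  exponent pattern found near \<open>\<plusminus>4\<close> into the subwords of the theorem.
\<close>

lemma alternating_word_periodic:
  assumes "\<And>j. j \<in> {1..2*k} \<Longrightarrow> n j = (if odd j then a else b)"
  shows "alternating_word n (2 * k) = word_power (letter_power Gen_A a @ letter_power Gen_B b) k"
  using assms
proof (induction k)
  case 0
  then show ?case by (simp add: alternating_word_def word_power_def)
next
  case (Suc k)
  have "alternating_word n (2 * Suc k) =
      alternating_word n (2 * k) @ letter_power Gen_A (n (2*k+1)) @ letter_power Gen_B (n (2*k+2))"
    by (simp add: alternating_word_def)
  also have "\<dots> = word_power (letter_power Gen_A a @ letter_power Gen_B b) k @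
      letter_power Gen_A a @ letter_power Gen_B b"
    using Suc by auto
  also have "\<dots> = word_power (letter_power Gen_A a @ letter_power Gen_B b) (Suc k)"
    by (simp add: word_power_def replicate_append_same[symmetric] del: replicate_Suc append_assoc)
       (simp add: replicate_append_same[symmetric])
  finally show ?case .
qed

lemma syl_alternating_word:
  assumes "\<And>j. j \<in> {1..k} \<Longrightarrow> n j \<noteq> 0"
  shows "syl (alternating_word n k) = k"
proof -
  let ?ss = "map (\<lambda>j. (if odd j then Gen_A else Gen_B, n j)) [1..<k+1]"
  have "\<forall>(x, m) \<in> set ?ss. m \<noteq> 0"
    using assms by auto
  moreover have "successively (\<lambda>a b. fst a \<noteq> fst b) ?ss"
    by (auto simp: successively_conv_nth simp del: upt_Suc)
  ultimately show ?thesis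
    using syl_syllables[of ?ss] by (simp add: alternating_word_def comp_def del: upt_Suc)
qed

text \<open>
  Passing to a subword can only cut or drop syllables at the two ends.
\<close>

lemma syl_mono_sublist:
  assumes "sublist v w"
  shows "syl v \<le> syl w"
proof -
  have skip: "length (remdups_adj ys) \<le> length (remdups_adj (y # ys))" for y :: 'b and ys
    by (auto simp: remdups_adj_Cons split: list.splits)
  have right: "length (remdups_adj ys) \<le> length (remdups_adj (xs @ ys))" for xs ys :: "'b list"
  proof (induction xs)
    case (Cons x xs)
    then show ?case using skip[of "xs @ ys" x] by simp
  qed simp
  have left: "length (remdups_adj xs) \<le> length (remdups_adj (xs @ ys))" for xs ys :: "'b list"
    using right[of "rev xs" "rev ys"] by (simp flip: rev_append)
  obtain ps qs where "w = ps @ v @ qs"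
    using assms by (auto simp: sublist_def)
  then have "map fst w = map fst ps @ map fst v @ map fst qs" by simp
  then show ?thesis
    unfolding syl_def by (metis left right order_trans)
qed

section \<open>The action on vectors\<close>

lemma mat_A_mult [simp]: "(mat_A c *v v) $ 1 = v $ 1 + c * v $ 2" "(mat_A c *v v) $ 2 = v $ 2"
  by (simp_all add: matrix_vector_mult_def mat_A_def sum_2)

lemma mat_B_mult [simp]: "(mat_B c *v v) $ 1 = v $ 1" "(mat_B c *v v) $ 2 = v $ 2 + c * v $ 1"
  by (simp_all add: matrix_vector_mult_def mat_B_def sum_2)

lemma group_SL2: "group SL2"
proof (rule groupI)
  fix M assume "M \<in> carrier SL2"
  then have "det M = 1" by (simp add: SL2_def)
  then have "invertible M" by (simp add: invertible_det_nz)
  then obtain M' where M': "M' ** M = mat 1" by (auto simp: invertible_def)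
  then have "det M' = 1" using \<open>det M = 1\<close> by (metis det_mul det_I mult.right_neutral)
  then show "\<exists>M'\<in>carrier SL2. M' \<otimes>\<^bsub>SL2\<^esub> M = \<one>\<^bsub>SL2\<^esub>"
    using M' by (auto simp: SL2_def)
qed (auto simp: SL2_def det_mul matrix_mul_assoc)

text \<open>
  The inverses in the subgroup generated by the two matrices are those of \<^const>\<open>SL2\<close>, hence
  explicit matrices. This lets a word act letter by letter as a product of explicit matrices.
\<close>

lemma inv_G_grp:
  "inv\<^bsub>G_grp l m\<^esub> (mat_A l) = mat_A (- l)" "inv\<^bsub>G_grp l m\<^esub> (mat_B m) = mat_B (- m)"
proof -
  interpret group SL2 by (rule group_SL2)
  have mem: "mat_A c \<in> carrier SL2" "mat_B c \<in> carrier SL2" for c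
    by (simp_all add: SL2_def mat_A_def mat_B_def det_2)
  have gen: "mat_A l \<in> carrier (G_grp l m)" "mat_B m \<in> carrier (G_grp l m)"
    unfolding G_grp_def using mem by (auto simp: carrier_subgroup_generated intro: generate.incl)
  have prod: "mat_A (- c) \<otimes>\<^bsub>SL2\<^esub> mat_A c = \<one>\<^bsub>SL2\<^esub>" "mat_B (- c) \<otimes>\<^bsub>SL2\<^esub> mat_B c = \<one>\<^bsub>SL2\<^esub>" for c
    by (simp_all add: SL2_def mat_A_def mat_B_def matrix_matrix_mult_def mat_def vec_eq_iff
        forall_2 sum_2)
  show "inv\<^bsub>G_grp l m\<^esub> (mat_A l) = mat_A (- l)" "inv\<^bsub>G_grp l m\<^esub> (mat_B m) = mat_B (- m)"
    using gen unfolding G_grp_def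
    by (simp_all add: inv_subgroup_generated inv_equality[OF prod(1) mem(1) mem(1)] inv_equality[OF prod(2) mem(2) mem(2)])
qed

context
  fixes l m :: complex
begin

abbreviation word_matrix :: "gen word \<Rightarrow> complex^2^2" where
  "word_matrix \<equiv> eval_word (G_grp l m) (gens l m)"

lemma word_matrix_Nil: "word_matrix [] *v v = v"
  by (simp add: eval_word_def G_grp_def subgroup_generated_def SL2_def)

lemma word_matrix_Cons: "word_matrix (a # w) *v v = eval_letter (G_grp l m) (gens l m) a *v (word_matrix w *v v)"
  by (simp add: eval_word_def G_grp_def subgroup_generated_def SL2_def matrix_vector_mul_assoc)

lemma word_matrix_letter_power:
  "word_matrix (letter_power Gen_A n @ w) *v v = mat_A (of_int n * l) *v (word_matrix w *v v)"
  "word_matrix (letter_power Gen_B n @ w) *v v = mat_B (of_int n * m) *v (word_matrix w *v v)"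
proof -
  have "word_matrix (replicate k (Gen_A, e) @ w) *v v =
      mat_A (of_int (if e then int k else - int k) * l) *v (word_matrix w *v v)" for k e
  proof (induction k)
    case 0
    show ?case by (simp add: vec_eq_iff forall_2)
  next
    case (Suc k)
    then show ?case
      by (cases e)
         (auto simp: word_matrix_Cons eval_letter_def inv_G_grp vec_eq_iff forall_2 algebra_simps)
  qed
  from this[of "nat \<bar>n\<bar>" "n > 0"]
  show "word_matrix (letter_power Gen_A n @ w) *v v = mat_A (of_int n * l) *v (word_matrix w *v v)"
    by (simp add: letter_power_def split: if_splits)
  have "word_matrix (replicate k (Gen_B, e) @ w) *v v =
      mat_B (of_int (if e then int k else - int k) * m) *v (word_matrix w *v v)" for k e
  proof (induction k)
    case 0
    show ?case by (simp add: vec_eq_iff forall_2)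
  next
    case (Suc k)
    then show ?case
      by (cases e)
         (auto simp: word_matrix_Cons eval_letter_def inv_G_grp vec_eq_iff forall_2 algebra_simps)
  qed
  from this[of "nat \<bar>n\<bar>" "n > 0"]
  show "word_matrix (letter_power Gen_B n @ w) *v v = mat_B (of_int n * m) *v (word_matrix w *v v)"
    by (simp add: letter_power_def split: if_splits)
qed

end

text \<open>
  In the coordinate \<open>p = x / (l y)\<close> of a vector \<open>(x, y)\<close> the matrix \<open>A\<^sup>n\<close> acts as \<open>p \<mapsto> p + n\<close>,
  and in the inverse coordinate \<open>1 / p\<close> the matrix \<open>B\<^sup>n\<close> acts as \<open>q \<mapsto> q + n \<nu>\<close> with \<open>\<nu> = l m\<close>. So
  for \<open>l \<noteq> 0\<close> only \<open>\<nu>\<close> matters, and \<open>gen_step\<close> is the translation by each generator in its own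
  coordinate.
\<close>

fun gen_step :: "complex \<Rightarrow> gen \<Rightarrow> complex" where
  "gen_step \<nu> Gen_A = 1"
| "gen_step \<nu> Gen_B = \<nu>"

text \<open>
  The value at the empty list together with \<open>inverse 0 = 0\<close> makes the innermost term \<open>n \<cdot>
  gen_step \<nu> x\<close>, which is the image of the point \<open>0\<close> in the coordinate of \<open>x\<close>.
\<close>

fun cont_frac :: "complex \<Rightarrow> (gen \<times> int) list \<Rightarrow> complex" where
  "cont_frac \<nu> [] = 0"
| "cont_frac \<nu> ((x, n) # ss) = of_int n * gen_step \<nu> x + inverse (cont_frac \<nu> ss)"

text \<open>
  The point \<open>0\<close> in the coordinate of the given generator, which is fixed by the other generator.
\<close>

fun start_vector :: "gen \<Rightarrow> complex^2" where
  "start_vector Gen_A = vector [0, 1]"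
| "start_vector Gen_B = vector [1, 0]"

text \<open>
  The coordinate in which the given generator acts as a translation.
\<close>

fun gen_slope :: "complex \<Rightarrow> gen \<Rightarrow> complex^2 \<Rightarrow> complex" where
  "gen_slope l Gen_A v = v $ 1 / (l * v $ 2)"
| "gen_slope l Gen_B v = l * v $ 2 / v $ 1"

text \<open>
  Each syllable changes the coordinate from \<open>z\<close> to \<open>n \<cdot> gen_step \<nu> x + 1 / z\<close>: passing from one
  generator to the other inverts the coordinate, and the syllable then translates it. As long as
  none of the values is \<open>0\<close>, the image vector stays off both coordinate axes, so that no
  division by zero occurs.
\<close>

lemma slope_word_matrix:
  assumes "l \<noteq> 0" "ss \<noteq> []" "proper_syllables ss"
    and "\<And>ss'. suffix ss' ss \<Longrightarrow> ss' \<noteq> [] \<Longrightarrow> cont_frac (l * m) ss' \<noteq> 0"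
  defines "v \<equiv> word_matrix l m (word_of_syllables ss) *v start_vector (fst (last ss))"
  shows "v $ 1 \<noteq> 0 \<and> v $ 2 \<noteq> 0 \<and> gen_slope l (fst (hd ss)) v = cont_frac (l * m) ss"
  using assms(2-4) unfolding v_def
proof (induction ss)
  case Nil
  then show ?case by simp
next
  case (Cons a ss)
  obtain x n where a: "a = (x, n)" by fastforce
  have nz: "cont_frac (l * m) (a # ss) \<noteq> 0" by (rule Cons.prems) auto
  show ?case
  proof (cases "ss = []")
    case True
    then show ?thesis
      using nz \<open>l \<noteq> 0\<close> word_matrix_letter_power[of l m n "[]"]
      by (cases x) (auto simp: a word_matrix_Nil)
  next
    case False
    define v where "v = word_matrix l m (word_of_syllables ss) *v start_vector (fst (last ss))"
    have "proper_syllables ss" "x \<noteq> fst (hd ss)"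
      using Cons.prems(2) False by (auto simp: a proper_syllables_Cons)
    moreover have "cont_frac (l * m) ss' \<noteq> 0" if "suffix ss' ss" "ss' \<noteq> []" for ss'
      using Cons.prems(3)[of ss'] that by (simp add: suffix_Cons)
    ultimately have IH: "v $ 1 \<noteq> 0" "v $ 2 \<noteq> 0" "gen_slope l (fst (hd ss)) v = cont_frac (l * m) ss"
      using Cons.IH False unfolding v_def by blast+
    show ?thesis
    proof (cases x)
      case Gen_A
      then have "fst (hd ss) = Gen_B"
        using \<open>x \<noteq> fst (hd ss)\<close> by (cases "fst (hd ss)") auto
      then have "cont_frac (l * m) (a # ss) = (v $ 1 + of_int n * l * v $ 2) / (l * v $ 2)"
        using IH \<open>l \<noteq> 0\<close> by (simp add: a Gen_A field_simps flip: IH(3))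
      then show ?thesis
        using nz False IH \<open>l \<noteq> 0\<close> by (auto simp: a Gen_A word_matrix_letter_power simp flip: v_def)
    next
      case Gen_B
      then have "fst (hd ss) = Gen_A"
        using \<open>x \<noteq> fst (hd ss)\<close> by (cases "fst (hd ss)") auto
      then have "cont_frac (l * m) (a # ss) = l * (v $ 2 + of_int n * m * v $ 1) / v $ 1"
        using IH \<open>l \<noteq> 0\<close> by (simp add: a Gen_B field_simps flip: IH(3))
      then show ?thesis
        using nz False IH \<open>l \<noteq> 0\<close> by (auto simp: a Gen_B word_matrix_letter_power simp flip: v_def)
    qed
  qed
qed

text \<open>
  The start vector lies on a coordinate axis and its image does not, so the word moves it.
\<close>

corollary not_relator_if_cont_frac_nonzero:
  assumes "l \<noteq> 0" "proper_syllables ss"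
    and "\<And>ss'. suffix ss' ss \<Longrightarrow> ss' \<noteq> [] \<Longrightarrow> cont_frac (l * m) ss' \<noteq> 0"
  shows "\<not> relator (G_grp l m) (gens l m) (word_of_syllables ss)"
proof
  assume rel: "relator (G_grp l m) (gens l m) (word_of_syllables ss)"
  then have "ss \<noteq> []" by (auto simp: relator_def)
  define v0 where "v0 = start_vector (fst (last ss))"
  have "word_matrix l m (word_of_syllables ss) = mat 1"
    using rel by (simp add: relator_def G_grp_def subgroup_generated_def SL2_def)
  then have "v0 $ 1 \<noteq> 0 \<and> v0 $ 2 \<noteq> 0"
    using slope_word_matrix[of l ss m] assms \<open>ss \<noteq> []\<close> by (simp add: v0_def)
  then show False
    unfolding v0_def by (cases "fst (last ss)") auto
qed

section \<open>Growth of the continued fraction\<close>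

text \<open>
  A lower bound for the size of the continued fraction after \<open>k\<close> consecutive dangerous
  syllables, when the size before them was at least \<open>3 / 2\<close>. The map \<open>u \<mapsto> 2 - 1 / u\<close> has the
  parabolic fixed point \<open>1\<close>, which is approached but never reached; this survives for boundedly
  many steps when \<open>2\<close> is replaced by a nearby \<open>t\<close>.
\<close>

primrec run_bound :: "real \<Rightarrow> nat \<Rightarrow> real" where
  "run_bound t 0 = 3 / 2"
| "run_bound t (Suc k) = t - inverse (run_bound t k)"

lemma run_bound_2: "run_bound 2 k = 1 + 1 / (real k + 2)"
proof (induction k)
  case (Suc k)
  have "1 + 1 / (real k + 2) = (real k + 3) / (real k + 2)"
    by (simp add: field_simps)
  then show ?case
    by (simp add: Suc) (simp add: field_simps)
qed simp

lemma isCont_run_bound: "isCont (\<lambda>t. run_bound t k) 2"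
proof (induction k)
  case (Suc k)
  have "run_bound 2 k \<noteq> 0"
    by (simp add: run_bound_2 add_eq_0_iff field_simps)
  then show ?case
    using Suc by (simp add: continuous_intros)
qed simp

lemma eventually_run_bound_ge_1:
  assumes "(t \<longlongrightarrow> 2) F"
  shows "\<forall>\<^sub>F x in F. \<forall>k\<le>K. run_bound (t x) k \<ge> 1"
proof -
  have "\<forall>\<^sub>F x in F. run_bound (t x) k > 1" for k
  proof (rule order_tendstoD)
    show "((\<lambda>x. run_bound (t x) k) \<longlongrightarrow> run_bound 2 k) F"
      using isCont_run_bound assms by (rule isCont_tendsto_compose)
  qed (simp add: run_bound_2)
  then have "\<forall>\<^sub>F x in F. \<forall>k\<in>{..K}. run_bound (t x) k > 1"
    by (simp add: eventually_ball_finite)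
  then show ?thesis
    by eventually_elim (auto intro: less_imp_le)
qed

text \<open>
  The number of dangerous syllables at the front: exponents \<open>\<plusminus>1\<close>, each pair of neighbouring
  exponents standing in the relation \<open>link\<close>. A syllable with exponent \<open>\<plusminus>1\<close> counts even if it is
  not linked to its successor.
\<close>

fun unit_run :: "(int \<Rightarrow> int \<Rightarrow> bool) \<Rightarrow> ('i \<times> int) list \<Rightarrow> nat" where
  "unit_run link [] = 0"
| "unit_run link ((x, n) # ss) =
     (if \<bar>n\<bar> \<noteq> 1 then 0
      else if ss \<noteq> [] \<and> link n (snd (hd ss)) then Suc (unit_run link ss)
      else 1)"

lemma unit_run_nth:
  assumes "j < unit_run link ss"
  shows "j < length ss" "\<bar>snd (ss ! j)\<bar> = 1"
    "Suc j < unit_run link ss \<Longrightarrow> link (snd (ss ! j)) (snd (ss ! Suc j))"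
proof -
  have "j < length ss \<and> \<bar>snd (ss ! j)\<bar> = 1 \<and>
      (Suc j < unit_run link ss \<longrightarrow> link (snd (ss ! j)) (snd (ss ! Suc j)))"
    using assms
  proof (induction ss arbitrary: j)
    case (Cons a ss)
    obtain x n where a: "a = (x, n)" by fastforce
    have n: "\<bar>n\<bar> = 1"
      using Cons.prems by (auto simp: a split: if_splits)
    show ?case
    proof (cases "ss \<noteq> [] \<and> link n (snd (hd ss))")
      case True
      then show ?thesis
        using Cons.prems n Cons.IH[of "j - 1"] by (cases j) (auto simp: a hd_conv_nth)
    next
      case False
      then show ?thesis
        using Cons.prems n by (auto simp: a split: if_splits)
    qed
  qed simp
  then show "j < length ss" "\<bar>snd (ss ! j)\<bar> = 1"
    "Suc j < unit_run link ss \<Longrightarrow> link (snd (ss ! j)) (snd (ss ! Suc j))"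
    by blast+
qed

lemma alternating_generators:
  fixes ss :: "(gen \<times> int) list"
  assumes "proper_syllables ss" "fst (hd ss) = Gen_A" "j < length ss"
  shows "fst (ss ! j) = (if even j then Gen_A else Gen_B)"
  using assms(3)
proof (induction j)
  case 0
  then show ?case using assms(2) by (simp add: hd_conv_nth)
next
  case (Suc j)
  then have "fst (ss ! j) \<noteq> fst (ss ! Suc j)"
    using assms(1) by (auto simp: proper_syllables_def successively_conv_nth)
  with Suc show ?case by (cases "fst (ss ! Suc j)") (auto split: if_splits)
qed

text \<open>
  The run may start with \<open>B\<close>, while alternating words start with \<open>A\<close>; dropping one syllable
  repairs this, which is why the run has to be longer than the word that it yields.
\<close>

lemma unit_run_alternating_word:
  fixes ss :: "(gen \<times> int) list"
  assumes "proper_syllables ss" "unit_run link ss > k"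
  obtains n where "sublist (alternating_word n k) (word_of_syllables ss)"
    "\<And>j. j \<in> {1..k} \<Longrightarrow> \<bar>n j\<bar> = 1"
    "\<And>j. j \<in> {1..<k} \<Longrightarrow> link (n j) (n (Suc j))"
proof -
  define d where "d = (if fst (hd ss) = Gen_A then 0 else 1 :: nat)"
  define n where "n j = snd (ss ! (d + j - 1))" for j
  have len: "k < length ss"
    using unit_run_nth(1)[OF assms(2)] .
  have "drop d ss = [] \<or> fst (hd (drop d ss)) = Gen_A"
  proof (cases "fst (hd ss)")
    case Gen_B
    then show ?thesis
      using assms(1) by (cases ss; cases "fst (hd (tl ss))") (auto simp: d_def proper_syllables_def successively_Cons)
  qed (simp add: d_def)
  moreover have "proper_syllables (drop d ss)"
    using assms(1) proper_syllables_append(2)[of "take d ss" "drop d ss"] by simp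
  ultimately have gens: "fst (drop d ss ! j) = (if even j then Gen_A else Gen_B)"
    if "j < length (drop d ss)" for j
    using that alternating_generators[of "drop d ss" j] by (cases "drop d ss = []") auto
  have d: "d \<le> 1" by (simp add: d_def)
  have "take k (drop d ss) = map (\<lambda>j. (if odd j then Gen_A else Gen_B, n j)) [1..<k+1]"
  proof (rule nth_equalityI)
    fix i assume "i < length (take k (drop d ss))"
    then have i: "i < k" "i < length (drop d ss)" by auto
    then show "take k (drop d ss) ! i = map (\<lambda>j. (if odd j then Gen_A else Gen_B, n j)) [1..<k+1] ! i"
      using gens[OF i(2)] by (auto simp: n_def prod_eq_iff simp del: upt_Suc)
  qed (use len d in auto)
  then have "word_of_syllables (take k (drop d ss)) = alternating_word n k"
    by (simp only: alternating_word_syllables)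
  moreover have "ss = take d ss @ take k (drop d ss) @ drop k (drop d ss)"
    by (simp only: append_take_drop_id)
  then have "word_of_syllables ss = word_of_syllables (take d ss) @
      word_of_syllables (take k (drop d ss)) @ word_of_syllables (drop k (drop d ss))"
    by (metis word_of_syllables_simps(3))
  ultimately have "sublist (alternating_word n k) (word_of_syllables ss)"
    by auto
  moreover have "\<bar>n j\<bar> = 1" if "j \<in> {1..k}" for j
    unfolding n_def using that d assms(2) by (intro unit_run_nth(2)[where link = link]) auto
  moreover have "link (n j) (n (Suc j))" if "j \<in> {1..<k}" for j
    using that d assms(2) unit_run_nth(3)[of "d + j - 1" link ss] by (auto simp: n_def)
  ultimately show ?thesis using that by blast
qed

text \<open>
  The ping-pong scheme. Both coordinates are measured by sizes such that \<open>n\<close> translation steps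
  have size at least \<open>t \<bar>n\<bar>\<close>, with \<open>t\<close> close to \<open>2\<close>, and the inverted coordinate subtracts at
  most the inverse of its size. The size \<open>1\<close> is critical: a step with exponent \<open>\<plusminus>1\<close> can bring it
  down towards \<open>1\<close>, all others bring it well above. If two neighbouring exponents \<open>\<plusminus>1\<close> are not
  linked, then the two steps do not work against each other and the size is at least \<open>t\<close> again.
  The bound \<open>5 / 4\<close> on \<open>t\<close> makes \<open>2 t - 1\<close>, a lower bound for the size after an exponent other
  than \<open>\<plusminus>1\<close>, at least \<open>3 / 2 = run_bound t 0\<close>.
\<close>

locale expanding_sizes =
  fixes \<nu> :: complex and N :: "gen \<Rightarrow> complex \<Rightarrow> real" and link :: "int \<Rightarrow> int \<Rightarrow> bool"
    and t :: real and K :: nat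
  assumes t_ge: "t \<ge> 5 / 4"
    and run_bound_ge_1: "\<And>k. k \<le> K \<Longrightarrow> run_bound t k \<ge> 1"
    and size_zero: "\<And>x. N x 0 = 0"
    and size_multiple: "\<And>x n. N x (of_int n * gen_step \<nu> x) \<ge> t * \<bar>n\<bar>"
    and size_step: "\<And>x y n z. x \<noteq> y \<Longrightarrow> N y z \<ge> 1 \<Longrightarrow>
      N x (of_int n * gen_step \<nu> x + inverse z) \<ge> t * \<bar>n\<bar> - inverse (N y z)"
    and size_unlinked: "\<And>x y n n' z. x \<noteq> y \<Longrightarrow> \<bar>n\<bar> = 1 \<Longrightarrow> \<bar>n'\<bar> = 1 \<Longrightarrow> \<not> link n n' \<Longrightarrow>
      z = 0 \<or> N x z \<ge> 1 \<Longrightarrow>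
      N x (of_int n * gen_step \<nu> x + inverse (of_int n' * gen_step \<nu> y + inverse z)) \<ge> t"
begin

text \<open>
  Along a dangerous run the size obeys the recursion of \<^const>\<open>run_bound\<close>; whenever the run
  is broken, the bound is started afresh. The case of two unlinked exponents looks two syllables
  ahead, which is why the induction is over the length.
\<close>

lemma size_cont_frac:
  assumes "ss \<noteq> []" "proper_syllables ss" "\<And>ss'. suffix ss' ss \<Longrightarrow> unit_run link ss' \<le> K"
  shows "N (fst (hd ss)) (cont_frac \<nu> ss) \<ge> run_bound t (unit_run link ss)"
  using assms
proof (induction ss rule: length_induct)
  case (1 ss)
  obtain x n ss1 where ss: "ss = (x, n) # ss1"
    using 1(2) by (cases ss) auto
  have n: "n \<noteq> 0" "proper_syllables ss1" "ss1 = [] \<or> x \<noteq> fst (hd ss1)"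
    using 1(3) by (auto simp: ss proper_syllables_Cons)
  have IH: "N (fst (hd ss')) (cont_frac \<nu> ss') \<ge> run_bound t (unit_run link ss')"
    "run_bound t (unit_run link ss') \<ge> 1" if "suffix ss' ss1" "ss' \<noteq> []" for ss'
  proof -
    have "suffix ss' ss" "length ss' < length ss"
      using that(1) by (auto simp: ss suffix_Cons dest: suffix_length_le)
    moreover have "proper_syllables ss'"
      using that(1) n(2) by (auto simp: suffix_def dest: proper_syllables_append)
    ultimately show "N (fst (hd ss')) (cont_frac \<nu> ss') \<ge> run_bound t (unit_run link ss')"
      using 1(1,4) that(2) suffix_order.trans by blast
    show "run_bound t (unit_run link ss') \<ge> 1"
      using \<open>suffix ss' ss\<close> 1(4) run_bound_ge_1 by blast
  qed
  have unit: "t * \<bar>n\<bar> = t" if "\<bar>n\<bar> = 1"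
    using that by simp
  have large: "t * \<bar>n\<bar> \<ge> 5 / 2" if "\<bar>n\<bar> \<noteq> 1"
  proof -
    have "real_of_int \<bar>n\<bar> \<ge> 2" using that n(1) by linarith
    then show ?thesis using mult_mono[of "5/4" t 2 "real_of_int \<bar>n\<bar>"] t_ge by simp
  qed
  show ?case
  proof (cases "ss1 = []")
    case True
    then have "N (fst (hd ss)) (cont_frac \<nu> ss) \<ge> t * \<bar>n\<bar>"
      using size_multiple[of n x] by (simp add: ss)
    then show ?thesis
      using unit large by (cases "\<bar>n\<bar> = 1") (auto simp: ss True)
  next
    case False
    let ?s = "N (fst (hd ss1)) (cont_frac \<nu> ss1)"
    have s: "?s \<ge> run_bound t (unit_run link ss1)" "run_bound t (unit_run link ss1) \<ge> 1"
      using IH(1)[of ss1] IH(2)[of ss1] False by simp_all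
    then have step: "N (fst (hd ss)) (cont_frac \<nu> ss) \<ge> t * \<bar>n\<bar> - inverse (run_bound t (unit_run link ss1))"
    proof -
      have "N x (cont_frac \<nu> ss) \<ge> t * \<bar>n\<bar> - inverse ?s"
        using size_step[of x "fst (hd ss1)" "cont_frac \<nu> ss1" n] n(3) False s by (simp add: ss)
      moreover have "inverse ?s \<le> inverse (run_bound t (unit_run link ss1))"
        using s by (intro le_imp_inverse_le) linarith+
      ultimately show ?thesis by (simp add: ss)
    qed
    have inv: "inverse (run_bound t (unit_run link ss1)) \<le> 1"
      using s(2) by (simp add: inverse_le_1_iff)
    obtain y n' ss2 where ss1: "ss1 = (y, n') # ss2"
      using False by (cases ss1) auto
    consider (big) "\<bar>n\<bar> \<noteq> 1" | (linked) "\<bar>n\<bar> = 1" "link n n'"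
      | (large_next) "\<bar>n\<bar> = 1" "\<not> link n n'" "\<bar>n'\<bar> \<noteq> 1"
      | (unlinked) "\<bar>n\<bar> = 1" "\<not> link n n'" "\<bar>n'\<bar> = 1" by blast
    then show ?thesis
    proof cases
      case big
      then show ?thesis using step inv large(1) by (simp add: ss)
    next
      case linked
      then show ?thesis using step unit[OF linked(1)] by (simp add: ss ss1)
    next
      case large_next
      then show ?thesis using step unit[OF large_next(1)] by (simp add: ss ss1)
    next
      case unlinked
      have xy: "x \<noteq> y" using n(3) by (simp add: ss1)
      have "cont_frac \<nu> ss2 = 0 \<or> N x (cont_frac \<nu> ss2) \<ge> 1"
      proof (cases "ss2 = []")
        case False
        then have "fst (hd ss2) \<noteq> y"
          using n(2) by (auto simp: ss1 proper_syllables_Cons)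
        then have "fst (hd ss2) = x"
          using xy by (cases x; cases y; cases "fst (hd ss2)") auto
        then show ?thesis
          using IH[of ss2] False by (auto simp: ss1 suffix_Cons)
      qed simp
      then have "N x (cont_frac \<nu> ss) \<ge> t"
        using size_unlinked[OF xy unlinked(1,3,2)] by (simp add: ss ss1)
      then show ?thesis using unlinked by (simp add: ss ss1)
    qed
  qed
qed

text \<open>
  If all runs had length at most \<open>K\<close>, all sizes would stay at least \<open>1\<close>, so no value of the
  continued fraction would vanish and the word would not be a relator.
\<close>

theorem relator_contains_linked_units:
  assumes "l \<noteq> 0" "\<nu> = l * m" "relator (G_grp l m) (gens l m) r"
  obtains n where "sublist (alternating_word n K) r"
    "\<And>j. j \<in> {1..K} \<Longrightarrow> n j \<in> {1, -1}"
    "\<And>j. j \<in> {1..<K} \<Longrightarrow> link (n j) (n (Suc j))"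
proof -
  obtain ss where ss: "proper_syllables ss" "r = word_of_syllables ss"
    using assms(3) reduced_word_has_syllables by (metis relator_def)
  have "\<exists>ss'. suffix ss' ss \<and> unit_run link ss' > K"
  proof (rule ccontr)
    assume "\<nexists>ss'. suffix ss' ss \<and> unit_run link ss' > K"
    then have short: "unit_run link ss' \<le> K" if "suffix ss' ss" for ss'
      using that by (meson not_le)
    have "cont_frac (l * m) ss' \<noteq> 0" if "suffix ss' ss" "ss' \<noteq> []" for ss'
    proof -
      have "proper_syllables ss'"
        using that(1) ss(1) by (auto simp: suffix_def dest: proper_syllables_append)
      then have "N (fst (hd ss')) (cont_frac \<nu> ss') \<ge> run_bound t (unit_run link ss')"
        using size_cont_frac[of ss'] that short suffix_order.trans by blast
      then show ?thesis
        using run_bound_ge_1[OF short[OF that(1)]] size_zero assms(2) by auto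
    qed
    then show False
      using not_relator_if_cont_frac_nonzero[of l ss m] assms ss by blast
  qed
  then obtain ss' where ss': "suffix ss' ss" "unit_run link ss' > K" by blast
  have "proper_syllables ss'"
    using ss'(1) ss(1) by (auto simp: suffix_def dest: proper_syllables_append)
  then obtain n where n: "sublist (alternating_word n K) (word_of_syllables ss')"
    "\<And>j. j \<in> {1..K} \<Longrightarrow> \<bar>n j\<bar> = 1" "\<And>j. j \<in> {1..<K} \<Longrightarrow> link (n j) (n (Suc j))"
    using unit_run_alternating_word ss'(2) by blast
  have "sublist (word_of_syllables ss') r"
    using ss'(1) by (auto simp: ss(2) suffix_def)
  then have "sublist (alternating_word n K) r"
    using n(1) sublist_order.order.trans by blast
  moreover have "n j \<in> {1, -1}" if "j \<in> {1..K}" for j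
    using n(2)[OF that] by auto
  ultimately show ?thesis using that n(3) by blast
qed

end

section \<open>Sizes near the four exceptional parameters\<close>

text \<open>
  Near \<open>\<plusminus>4\<close> the modulus works as in Sanov's theorem. The factors \<open>2\<close> and \<open>1 / 2\<close> correspond to
  rescaling the coordinates so that both translations have modulus close to \<open>2\<close>.
\<close>

fun modulus_size :: "gen \<Rightarrow> complex \<Rightarrow> real" where
  "modulus_size Gen_A z = 2 * cmod z"
| "modulus_size Gen_B z = cmod z / 2"

text \<open>
  Near \<open>\<plusminus>2\<i>\<close> the two generators translate in nearly orthogonal directions, and the size is a
  multiple of the distance to a line through \<open>0\<close>, the middle of a strip that the generator
  translates off itself. The complement of a strip about \<open>0\<close> is mapped by inversion to two discs
  tangent at \<open>0\<close>, and these lie in a strip in the other direction.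
\<close>

fun strip_size :: "gen \<Rightarrow> complex \<Rightarrow> real" where
  "strip_size Gen_A z = 2 * \<bar>Re z\<bar>"
| "strip_size Gen_B z = \<bar>Im z\<bar>"

lemma modulus_size_inverse: "x \<noteq> y \<Longrightarrow> modulus_size x (inverse z) = inverse (modulus_size y z)"
  by (cases x; cases y) (simp_all add: norm_divide inverse_eq_divide)

lemma modulus_size_triangle: "modulus_size x (z + w) \<ge> modulus_size x z - modulus_size x w"
  using norm_diff_ineq[of z w] by (cases x) auto

lemma modulus_size_mult: "modulus_size x (z * w) = modulus_size x z * cmod w"
  by (cases x) (auto simp: norm_mult)

text \<open>
  If \<open>n n' = \<epsilon>\<close>, the two translations \<open>n g\<^sub>x\<close> and \<open>n' g\<^sub>y\<close> multiply to \<open>\<epsilon> \<nu>\<close>, which has large real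
  part by assumption. The term \<open>n g\<^sub>x / z\<close> is too small to bring the product into the left half
  plane, so the value is \<open>n g\<^sub>x\<close> times some \<open>1 + 1 / u\<close> with \<open>Re u \<ge> 0\<close>, which does not decrease
  the modulus. Only the other sign pattern, where the two steps work against each other, is
  dangerous.
\<close>

lemma expanding_sizes_near_4:
  fixes \<epsilon> :: int
  assumes "\<bar>\<epsilon>\<bar> = 1" and Re: "Re (of_int \<epsilon> * \<nu>) \<ge> max 2 (cmod \<nu> / 2)"
    and "t \<ge> 5 / 4" "t \<le> 2" "t \<le> cmod \<nu> / 2" "\<forall>k\<le>K. run_bound t k \<ge> 1"
  shows "expanding_sizes \<nu> modulus_size (\<lambda>n n'. n' = - \<epsilon> * n) t K"
proof
  show mult: "modulus_size x (of_int n * gen_step \<nu> x) \<ge> t * \<bar>n\<bar>" for x n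
    using mult_right_mono[OF assms(4), of "\<bar>real_of_int n\<bar>"]
      mult_right_mono[OF assms(5), of "\<bar>real_of_int n\<bar>"]
    by (cases x) (auto simp: norm_mult mult.commute)
  show "modulus_size x (of_int n * gen_step \<nu> x + inverse z) \<ge> t * \<bar>n\<bar> - inverse (modulus_size y z)"
    if "x \<noteq> y" for x y n z
    using mult[of n x] modulus_size_triangle[of x "of_int n * gen_step \<nu> x" "inverse z"]
      modulus_size_inverse[OF that, of z] by linarith
  show "modulus_size x 0 = 0" for x
    by (cases x) auto
  show "modulus_size x (of_int n * gen_step \<nu> x + inverse (of_int n' * gen_step \<nu> y + inverse z)) \<ge> t"
    if "x \<noteq> y" "\<bar>n\<bar> = 1" "\<bar>n'\<bar> = 1" "\<not> n' = - \<epsilon> * n" and z: "z = 0 \<or> modulus_size x z \<ge> 1"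
    for x y n n' z
  proof -
    define c where "c = of_int n * gen_step \<nu> x"
    define w where "w = of_int n' * gen_step \<nu> y + inverse z"
    define u where "u = c * w"
    have nn': "n * n' = \<epsilon>" "n * n = 1"
      using that(2-4) assms(1) by (auto simp: abs_if split: if_splits)
    have "gen_step \<nu> x * gen_step \<nu> y = \<nu>"
      using \<open>x \<noteq> y\<close> by (cases x; cases y) auto
    then have "u = of_int (n * n') * \<nu> + c * inverse z"
      by (simp add: u_def w_def c_def algebra_simps)
    then have "Re u = Re (of_int \<epsilon> * \<nu>) + Re (c * inverse z)"
      by (simp only: nn' plus_complex.sel)
    moreover have "cmod (c * inverse z) \<le> max 2 (cmod \<nu> / 2)"
    proof (cases "z = 0")
      case False
      then have "cmod z > 0" by simp
      moreover have "cmod \<nu> * 2 \<le> cmod \<nu> * cmod z" if "cmod z \<ge> 2"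
        using that by (intro mult_left_mono) auto
      ultimately show ?thesis
        using z False \<open>\<bar>n\<bar> = 1\<close>
        by (cases x) (auto simp: c_def norm_mult norm_divide le_max_iff_disj divide_simps
            simp flip: of_int_abs)
    qed simp
    then have "Re (c * inverse z) \<ge> - max 2 (cmod \<nu> / 2)"
      using abs_Re_le_cmod[of "c * inverse z"] by linarith
    ultimately have "Re u \<ge> 0"
      using Re by linarith
    then have "Re (1 + inverse u) \<ge> 1"
      by simp
    then have "cmod (1 + inverse u) \<ge> 1"
      using complex_Re_le_cmod[of "1 + inverse u"] by linarith
    have "\<nu> \<noteq> 0" using assms(3,5) by auto
    then have "c \<noteq> 0" using that(2) by (cases x) (auto simp: c_def)
    then have "c + inverse w = c * (1 + inverse u)"
      by (simp add: u_def distrib_left)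
    then have "modulus_size x (c + inverse w) = modulus_size x c * cmod (1 + inverse u)"
      by (simp only: modulus_size_mult)
    moreover have "modulus_size x c \<ge> t"
      using mult[of n x] that(2) by (simp add: c_def flip: of_int_abs)
    then have "modulus_size x c * cmod (1 + inverse u) \<ge> t * 1"
      using \<open>cmod (1 + inverse u) \<ge> 1\<close> assms(3) by (intro mult_mono) auto
    ultimately show ?thesis
      by (simp add: c_def w_def)
  qed
qed (use assms in auto)

lemma strip_size_inverse:
  assumes "x \<noteq> y" "strip_size y z \<ge> 1"
  shows "strip_size x (inverse z) \<le> inverse (strip_size y z)"
proof -
  define D where "D = (Re z)\<^sup>2 + (Im z)\<^sup>2"
  \<comment> \<open>By the inequality of arithmetic and geometric means both inverted parts are as small as required.\<close>
  have amgm: "(2 * \<bar>Re z\<bar>) * \<bar>Im z\<bar> \<le> D"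
    using sum_squares_bound[of "\<bar>Re z\<bar>" "\<bar>Im z\<bar>"] by (simp add: D_def)
  have "Re z \<noteq> 0 \<or> Im z \<noteq> 0"
    using assms(2) by (cases y) auto
  then have "D > 0"
    by (simp add: D_def sum_power2_gt_zero_iff)
  then have parts: "\<bar>Re (inverse z)\<bar> = \<bar>Re z\<bar> / D" "\<bar>Im (inverse z)\<bar> = \<bar>Im z\<bar> / D"
    by (simp_all add: D_def)
  have quot: "a / D \<le> inverse b" if "a * b \<le> D" "b \<ge> 1" for a b
    using that \<open>D > 0\<close> by (simp add: field_simps)
  show ?thesis
  proof (cases x)
    case Gen_A
    then show ?thesis
      using assms quot[OF amgm] by (cases y) (simp_all add: parts del: inverse_complex.sel)
  next
    case Gen_B
    then show ?thesis
      using assms quot[of "\<bar>Im z\<bar>" "2 * \<bar>Re z\<bar>"] amgm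
      by (cases y) (simp_all add: parts mult.commute del: inverse_complex.sel)
  qed
qed

lemma strip_size_triangle: "strip_size x (z + w) \<ge> strip_size x z - strip_size x w"
  using abs_triangle_ineq2[of "Re z" "- Re w"] abs_triangle_ineq2[of "Im z" "- Im w"]
  by (cases x) auto

lemma expanding_sizes_near_2i:
  assumes "t \<ge> 5 / 4" "t \<le> 2" "t \<le> \<bar>Im \<nu>\<bar>" "\<forall>k\<le>K. run_bound t k \<ge> 1"
  shows "expanding_sizes \<nu> strip_size (\<lambda>_ _. True) t K"
proof
  show mult: "strip_size x (of_int n * gen_step \<nu> x) \<ge> t * \<bar>n\<bar>" for x n
    using mult_right_mono[OF assms(2), of "\<bar>real_of_int n\<bar>"]
      mult_right_mono[OF assms(3), of "\<bar>real_of_int n\<bar>"]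
    by (cases x) (auto simp: abs_mult mult.commute)
  show "strip_size x (of_int n * gen_step \<nu> x + inverse z) \<ge> t * \<bar>n\<bar> - inverse (strip_size y z)"
    if "x \<noteq> y" "strip_size y z \<ge> 1" for x y n z
    using mult[of n x] strip_size_triangle[of x "of_int n * gen_step \<nu> x" "inverse z"]
      strip_size_inverse[OF that] by linarith
  show "strip_size x 0 = 0" for x
    by (cases x) auto
qed (use assms in auto)

definition contains_linked_units :: "(int \<Rightarrow> int \<Rightarrow> bool) \<Rightarrow> nat \<Rightarrow> gen word \<Rightarrow> bool" where
  "contains_linked_units link k r \<longleftrightarrow>
     (\<exists>n. sublist (alternating_word n k) r \<and> (\<forall>j\<in>{1..k}. n j \<in> {1, -1}) \<and>
          (\<forall>j\<in>{1..<k}. link (n j) (n (Suc j))))"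

lemma eventually_contains_linked_units:
  fixes lam mu :: "'a \<Rightarrow> complex" and t :: "'a \<Rightarrow> real"
  assumes "(t \<longlongrightarrow> 2) F" "\<forall>\<^sub>F i in F. lam i \<noteq> 0"
    and sizes: "\<forall>\<^sub>F i in F. t i \<ge> 5 / 4 \<longrightarrow> (\<forall>k\<le>K. run_bound (t i) k \<ge> 1) \<longrightarrow>
      expanding_sizes (lam i * mu i) N link (t i) K"
  shows "\<forall>\<^sub>F i in F. \<forall>r. relator (G_grp (lam i) (mu i)) (gens (lam i) (mu i)) r \<longrightarrow>
           contains_linked_units link K r"
proof -
  have "\<forall>\<^sub>F i in F. t i > 5 / 4"
    by (rule order_tendstoD[OF assms(1)]) simp
  then show ?thesis
    using assms(2) eventually_run_bound_ge_1[OF assms(1), of K] sizes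
  proof eventually_elim
    case (elim i)
    then interpret expanding_sizes "lam i * mu i" N link "t i" K by simp
    show ?case
    proof (intro allI impI)
      fix r assume "relator (G_grp (lam i) (mu i)) (gens (lam i) (mu i)) r"
      from relator_contains_linked_units[OF elim(2) refl this]
      obtain n where "sublist (alternating_word n K) r" "\<And>j. j \<in> {1..K} \<Longrightarrow> n j \<in> {1, -1}"
        "\<And>j. j \<in> {1..<K} \<Longrightarrow> link (n j) (n (Suc j))"
        by metis
      then show "contains_linked_units link K r"
        unfolding contains_linked_units_def by (intro exI[of _ n]) simp
    qed
  qed
qed

lemma eventually_contains_linked_units_near_4:
  fixes lam mu :: "'a \<Rightarrow> complex" and \<epsilon> :: int
  assumes "((\<lambda>i. lam i * mu i) \<longlongrightarrow> of_int (4 * \<epsilon>)) F" "\<bar>\<epsilon>\<bar> = 1"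
  shows "\<forall>\<^sub>F i in F. \<forall>r. relator (G_grp (lam i) (mu i)) (gens (lam i) (mu i)) r \<longrightarrow>
           contains_linked_units (\<lambda>n n'. n' = - \<epsilon> * n) K r"
proof (rule eventually_contains_linked_units)
  have lim: "((\<lambda>i. cmod (lam i * mu i) / 2) \<longlongrightarrow> 2) F"
    using tendsto_divide[OF tendsto_norm[OF assms(1)] tendsto_const[of 2]] assms(2)
    by (simp add: norm_mult flip: of_int_abs)
  show "((\<lambda>i. min 2 (cmod (lam i * mu i) / 2)) \<longlongrightarrow> 2) F"
    using tendsto_min[OF tendsto_const[of 2] lim] by simp
  show "\<forall>\<^sub>F i in F. lam i \<noteq> 0"
    using order_tendstoD(1)[OF lim, of 0] by (auto elim: eventually_mono)
  have "of_int \<epsilon> * of_int (4 * \<epsilon>) = (4::complex)"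
    using assms(2) by (auto simp: abs_if split: if_splits)
  then have "((\<lambda>i. Re (of_int \<epsilon> * (lam i * mu i))) \<longlongrightarrow> 4) F"
    using tendsto_Re[OF tendsto_mult[OF tendsto_const assms(1), of "of_int \<epsilon>"]]
    by (simp only: complex_Re_numeral)
  then have "\<forall>\<^sub>F i in F. Re (of_int \<epsilon> * (lam i * mu i)) > 3"
    by (rule order_tendstoD) simp
  moreover have "\<forall>\<^sub>F i in F. cmod (lam i * mu i) / 2 < 3"
    by (rule order_tendstoD[OF lim]) simp
  ultimately show "\<forall>\<^sub>F i in F. min 2 (cmod (lam i * mu i) / 2) \<ge> 5 / 4 \<longrightarrow>
      (\<forall>k\<le>K. run_bound (min 2 (cmod (lam i * mu i) / 2)) k \<ge> 1) \<longrightarrow>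
      expanding_sizes (lam i * mu i) modulus_size (\<lambda>n n'. n' = - \<epsilon> * n)
        (min 2 (cmod (lam i * mu i) / 2)) K"
  proof eventually_elim
    case (elim i)
    show ?case
      by (intro impI expanding_sizes_near_4 assms(2)) (use elim in auto)
  qed
qed

lemma eventually_contains_linked_units_near_2i:
  fixes lam mu :: "'a \<Rightarrow> complex"
  assumes "((\<lambda>i. lam i * mu i) \<longlongrightarrow> l) F" "\<bar>Im l\<bar> = 2"
  shows "\<forall>\<^sub>F i in F. \<forall>r. relator (G_grp (lam i) (mu i)) (gens (lam i) (mu i)) r \<longrightarrow>
           contains_linked_units (\<lambda>_ _. True) K r"
proof (rule eventually_contains_linked_units)
  have lim: "((\<lambda>i. \<bar>Im (lam i * mu i)\<bar>) \<longlongrightarrow> 2) F"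
    using tendsto_rabs[OF tendsto_Im[OF assms(1)]] assms(2) by simp
  show "((\<lambda>i. min 2 \<bar>Im (lam i * mu i)\<bar>) \<longlongrightarrow> 2) F"
    using tendsto_min[OF tendsto_const[of 2] lim] by simp
  show "\<forall>\<^sub>F i in F. lam i \<noteq> 0"
    using order_tendstoD(1)[OF lim, of 0] by (auto elim: eventually_mono)
  show "\<forall>\<^sub>F i in F. min 2 \<bar>Im (lam i * mu i)\<bar> \<ge> 5 / 4 \<longrightarrow>
      (\<forall>k\<le>K. run_bound (min 2 \<bar>Im (lam i * mu i)\<bar>) k \<ge> 1) \<longrightarrow>
      expanding_sizes (lam i * mu i) strip_size (\<lambda>_ _. True) (min 2 \<bar>Im (lam i * mu i)\<bar>) K"
    by (intro always_eventually allI impI expanding_sizes_near_2i) auto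
qed

section \<open>Subwords and syllables of relators\<close>

text \<open>
  The linking relation makes the exponents periodic with period two, since \<open>\<epsilon>\<^sup>2 = 1\<close>.
\<close>

lemma linked_units_power:
  fixes \<epsilon> :: int
  assumes "contains_linked_units (\<lambda>n n'. n' = - \<epsilon> * n) (2 * k) r" "k > 0" "\<bar>\<epsilon>\<bar> = 1"
  shows "sublist (word_power (letter_power Gen_A 1 @ letter_power Gen_B (- \<epsilon>)) k) r \<or>
         sublist (word_power (letter_power Gen_A (-1) @ letter_power Gen_B \<epsilon>) k) r"
proof -
  obtain n where n: "sublist (alternating_word n (2 * k)) r" "\<forall>j\<in>{1..2*k}. n j \<in> {1, -1}"
    and link: "\<forall>j\<in>{1..<2*k}. n (Suc j) = - \<epsilon> * n j"
    using assms(1) unfolding contains_linked_units_def by blast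
  have "\<epsilon> * \<epsilon> = 1"
    using assms(3) by (auto simp: abs_if split: if_splits)
  have "n j = (if odd j then n 1 else - \<epsilon> * n 1)" if "1 \<le> j" "j \<le> 2 * k" for j
    using that
  proof (induction j rule: dec_induct)
    case (step j)
    then show ?case
      using link \<open>\<epsilon> * \<epsilon> = 1\<close> by (auto simp: mult.assoc[symmetric])
  qed simp
  then have "alternating_word n (2 * k) =
      word_power (letter_power Gen_A (n 1) @ letter_power Gen_B (- \<epsilon> * n 1)) k"
    by (intro alternating_word_periodic) auto
  moreover have "n 1 \<in> {1, -1}"
    using n(2) assms(2) by simp
  ultimately show ?thesis
    using n(1) by auto
qed

lemma syl_ge_linked_units:
  assumes "contains_linked_units link k r"
  shows "syl r \<ge> k"
proof -
  obtain n where n: "sublist (alternating_word n k) r" "\<forall>j\<in>{1..k}. n j \<in> {1, -1}"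
    using assms unfolding contains_linked_units_def by blast
  then have "syl (alternating_word n k) = k"
    by (intro syl_alternating_word) force
  then show ?thesis
    using syl_mono_sublist[OF n(1)] by simp
qed

lemma tendsto_infinity_enat:
  fixes f :: "'a \<Rightarrow> enat"
  assumes "\<And>k. \<forall>\<^sub>F i in F. f i \<ge> enat k"
  shows "(f \<longlongrightarrow> \<infinity>) F"
proof (rule order_tendstoI)
  fix a :: enat assume "a < \<infinity>"
  then obtain k where "a = enat k" by (cases a) auto
  then show "\<forall>\<^sub>F i in F. a < f i"
    using assms[of "Suc k"] by (auto elim!: eventually_mono intro: less_le_trans[of _ "enat (Suc k)"])
qed simp

theorem corollary1p3:
  fixes lam mu :: "nat \<Rightarrow> complex" and l :: complex
  assumes "(\<lambda>n. lam n * mu n) \<longlonglongrightarrow> l"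
    and "l \<in> {4, -4, 2 * \<i>, -2 * \<i>}"
  shows "(\<forall>K::nat. \<exists>N::nat. \<forall>n\<ge>N. \<forall>r. relator (G_grp (lam n) (mu n)) (gens (lam n) (mu n)) r \<longrightarrow>
           (l = 4 \<longrightarrow>
              (\<exists>w k. sublist w r \<and> k \<ge> K \<and>
                 (w = word_power (letter_power Gen_A 1 @ letter_power Gen_B (-1)) k \<or>
                  w = word_power (letter_power Gen_A (-1) @ letter_power Gen_B 1) k))) \<and>
           (l = -4 \<longrightarrow>
              (\<exists>w k. sublist w r \<and> k \<ge> K \<and>
                 (w = word_power (letter_power Gen_A 1 @ letter_power Gen_B 1) k \<or>
                  w = word_power (letter_power Gen_A (-1) @ letter_power Gen_B (-1)) k))) \<and>
           (l \<in> {2 * \<i>, -2 * \<i>} \<longrightarrow>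
              (\<exists>w k n'. sublist w r \<and> k \<ge> K \<and> even k \<and> (\<forall>j\<in>{1..k}. n' j \<in> {1, -1}) \<and>
                 w = alternating_word n' k)))
         \<and> (\<lambda>n. min_syl (G_grp (lam n) (mu n)) (gens (lam n) (mu n))) \<longlonglongrightarrow> \<infinity>"
proof -
  let ?rel = "\<lambda>n. relator (G_grp (lam n) (mu n)) (gens (lam n) (mu n))"
  \<comment> \<open>A product of neighbouring exponents equal to \<open>-1\<close> is dangerous at \<open>4\<close>, and one equal to \<open>1\<close> at \<open>-4\<close>.\<close>
  define link :: "int \<Rightarrow> int \<Rightarrow> bool" where
    "link n n' \<longleftrightarrow> (l = 4 \<longrightarrow> n' = - n) \<and> (l = -4 \<longrightarrow> n' = n)" for n n'
  have ev: "\<forall>\<^sub>F n in sequentially. \<forall>r. ?rel n r \<longrightarrow> contains_linked_units link K r" for K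
  proof -
    consider "l = 4" | "l = -4" | "l \<in> {2 * \<i>, -2 * \<i>}"
      using assms(2) by blast
    then show ?thesis
    proof cases
      case 1
      then have "link = (\<lambda>n n'. n' = - 1 * n)" by (simp add: link_def fun_eq_iff)
      then show ?thesis
        using eventually_contains_linked_units_near_4[of lam mu 1] assms(1) 1 by simp
    next
      case 2
      then have "link = (\<lambda>n n'. n' = - (-1) * n)" by (simp add: link_def fun_eq_iff)
      then show ?thesis
        using eventually_contains_linked_units_near_4[of lam mu "-1"] assms(1) 2 by simp
    next
      case 3
      then have "\<bar>Im l\<bar> = 2" by auto
      then have "l \<noteq> 4" "l \<noteq> -4" by auto
      then have "link = (\<lambda>_ _. True)" by (simp add: link_def fun_eq_iff)
      then show ?thesis
        using eventually_contains_linked_units_near_2i[OF assms(1) \<open>\<bar>Im l\<bar> = 2\<close>] by simp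
    qed
  qed
  have "\<exists>N. \<forall>n\<ge>N. \<forall>r. ?rel n r \<longrightarrow>
           (l = 4 \<longrightarrow>
              (\<exists>w k. sublist w r \<and> k \<ge> K \<and>
                 (w = word_power (letter_power Gen_A 1 @ letter_power Gen_B (-1)) k \<or>
                  w = word_power (letter_power Gen_A (-1) @ letter_power Gen_B 1) k))) \<and>
           (l = -4 \<longrightarrow>
              (\<exists>w k. sublist w r \<and> k \<ge> K \<and>
                 (w = word_power (letter_power Gen_A 1 @ letter_power Gen_B 1) k \<or>
                  w = word_power (letter_power Gen_A (-1) @ letter_power Gen_B (-1)) k))) \<and>
           (l \<in> {2 * \<i>, -2 * \<i>} \<longrightarrow>
              (\<exists>w k n'. sublist w r \<and> k \<ge> K \<and> even k \<and> (\<forall>j\<in>{1..k}. n' j \<in> {1, -1}) \<and>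
                 w = alternating_word n' k))" for K
  proof -
    \<comment> \<open>One more pair than needed, so that the pattern is nonempty and has a first exponent also for \<open>K = 0\<close>.\<close>
    obtain N where N: "\<And>n r. n \<ge> N \<Longrightarrow> ?rel n r \<Longrightarrow> contains_linked_units link (2 * Suc K) r"
      using ev[of "2 * Suc K"] unfolding eventually_sequentially by blast
    show ?thesis
    proof (intro exI[of _ N] allI impI conjI)
      fix n r assume n: "N \<le> n" "?rel n r"
      note units = N[OF n]
      {
        assume "l = 4"
        then have "link = (\<lambda>n n'. n' = - 1 * n)" by (simp add: link_def fun_eq_iff)
        then show "\<exists>w k. sublist w r \<and> k \<ge> K \<and>
            (w = word_power (letter_power Gen_A 1 @ letter_power Gen_B (-1)) k \<or>
             w = word_power (letter_power Gen_A (-1) @ letter_power Gen_B 1) k)"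
          using linked_units_power[of 1 "Suc K" r] units by (metis abs_one le_SucI order_refl zero_less_Suc)
      next
        assume "l = -4"
        then have "link = (\<lambda>n n'. n' = - (-1) * n)" by (simp add: link_def fun_eq_iff)
        then have "sublist (word_power (letter_power Gen_A 1 @ letter_power Gen_B 1) (Suc K)) r \<or>
            sublist (word_power (letter_power Gen_A (-1) @ letter_power Gen_B (-1)) (Suc K)) r"
          using linked_units_power[of "-1" "Suc K" r] units by simp
        then show "\<exists>w k. sublist w r \<and> k \<ge> K \<and>
            (w = word_power (letter_power Gen_A 1 @ letter_power Gen_B 1) k \<or>
             w = word_power (letter_power Gen_A (-1) @ letter_power Gen_B (-1)) k)"
          by (metis le_SucI order_refl)
      next
        obtain n' where "sublist (alternating_word n' (2 * Suc K)) r" "\<forall>j\<in>{1..2 * Suc K}. n' j \<in> {1, -1}"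
          using units unfolding contains_linked_units_def by blast
        then show "\<exists>w k n'. sublist w r \<and> k \<ge> K \<and> even k \<and> (\<forall>j\<in>{1..k}. n' j \<in> {1, -1}) \<and>
            w = alternating_word n' k"
          by (intro exI[of _ "alternating_word n' (2 * Suc K)"] exI[of _ "2 * Suc K"] exI[of _ n']) auto
      }
    qed
  qed
  moreover have "(\<lambda>n. min_syl (G_grp (lam n) (mu n)) (gens (lam n) (mu n))) \<longlonglongrightarrow> \<infinity>"
  proof (rule tendsto_infinity_enat)
    fix k
    show "\<forall>\<^sub>F n in sequentially. min_syl (G_grp (lam n) (mu n)) (gens (lam n) (mu n)) \<ge> enat k"
      using ev[of k]
    proof eventually_elim
      case (elim n)
      then show ?case
        unfolding min_syl_def by (intro INF_greatest) (auto dest: syl_ge_linked_units)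
    qed
  qed
  ultimately show ?thesis by blast
qed

end
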